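(* Given sets of correct and faulty servers, $\mathbf{V}_{\mathrm{ok}}$ and $\mathbf{V}_{\mathrm{bad}}$, let $(\{\mathcal{Q}_v\}_{v\in\mathbf{V}_{\mathrm{ok}}},\{\mathcal{B}_v\}_{v\in\mathbf{V}_{\mathrm{ok}}})$ be a subjective dissemination quorum system. Then Bracha broadcast over this system implements reliable Byzantine broadcast (Validity, No duplication, Integrity, Consistency and Totality).
   Context: System model. There is a set of clients $\mathbf{C}$ and a disjoint finite non-empty set of servers $\mathbf{V}=\mathbf{V}_{\mathrm{ok}}\uplus\mathbf{V}_{\mathrm{bad}}$, with $\mathbf{V}_{\mathrm{ok}}$ the correct and $\mathbf{V}_{\mathrm{bad}}$ the faulty servers. Correct nodes follow their protocol; faulty (Byzantine) nodes behave arbitrarily. One distinguished client $c$ is the sender; it may be correct or faulty. Any two nodes communicate over an asynchronous point-to-point channel. If both endpoints are correct, the channel is authenticated and reliable: a correct node receives (eventually, after an arbitrary finite delay) a message from another correct node if and only if the latter sent it. Servers also send messages to themselves. Executions are complete: a handler of a correct server that stays enabled is eventually executed. A correct sender broadcasts at most one value. A quorum system is a non-empty set $\mathcal{Q}\subseteq 2^{\mathbf{V}}$ such that every $U\in\mathcal{Q}$ is non-empty, any two $U_1,U_2\in\mathcal{Q}$ intersect, and $\mathcal{Q}$ is closed under binary union. A fail-prone system is a non-empty set $\mathcal{B}\subseteq 2^{\mathbf{V}}$ none of whose elements is contained in another. A subjective Byzantine quorum system is a pair $(\{\mathcal{Q}_v\}_{v\in\mathbf{V}_{\mathrm{ok}}},\{\mathcal{B}_v\}_{v\in\mathbf{V}_{\mathrm{ok}}})$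 where each $\mathcal{Q}_v$ is a quorum system and each $\mathcal{B}_v$ a fail-prone system. It is a subjective dissemination quorum system when the following hold. SD-safety: $\forall v\in\mathbf{V}_{\mathrm{ok}}.\ \exists B\in\mathcal{B}_v.\ \mathbf{V}_{\mathrm{bad}}\subseteq B$. SD-consistency: $\forall v\in\mathbf{V}_{\mathrm{ok}}.\ \forall U_1\in\mathcal{Q}_v.\ \forall U_2\in\bigcup_{v'\in\mathbf{V}_{\mathrm{ok}}}\mathcal{Q}_{v'}.\ \forall B\in\mathcal{B}_v.\ \mathbf{V}_{\mathrm{bad}}\subseteq B\implies U_1\cap U_2\not\subseteq B$. SD-availability: $\forall v\in\mathbf{V}_{\mathrm{ok}}.\ \forall B\in\mathcal{B}_v.\ \exists U\in\mathcal{Q}_v.\ U\cap B=\emptyset$. Bracha broadcast over the subjective system (each correct server acts according to its own view). To broadcast a value $a$, the sender $c$ sends $\mathtt{BCAST}(a)$ to every server. Each correct server $v$ has Boolean variables echoed, ready, delivered, all initially false, and the following handlers. (1) When $v$ has received $\mathtt{BCAST}(a)$ from $c$ and echoed is false: set echoed to true and send $\mathtt{ECHO}(a)$ to every server. (2) When $v$ has received $\mathtt{ECHO}(a)$ from every $u\in U$ for some $U\in\mathcal{Q}_v$, and ready is false: set ready to true and send $\mathtt{READY}(a)$ to every server. (3) When $v$ has received $\mathtt{READY}(a)$ from every $u\in B$ for some non-empty $B\subseteq\mathbf{V}$ such that $B\not\subseteq B'$ for all $B'\in\mathcal{B}_v$, and ready is false: set ready to true and send $\mathtt{READY}(a)$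 to every server. (4) When $v$ has received $\mathtt{READY}(a)$ from every $u\in U$ for some $U\in\mathcal{Q}_v$, and delivered is false: set delivered to true and deliver $a$. Reliable Byzantine broadcast. Validity: if the sender is correct and broadcasts a value $a$, then every correct server eventually delivers $a$. No duplication: every correct server delivers at most one value. Integrity: if some correct server delivers a value $a$ and the sender is correct, then $a$ was previously broadcast by the sender. Consistency: if some correct server delivers $a$ and another correct server delivers $a'$, then $a=a'$. Totality: if a correct server delivers a value, then every correct server eventually delivers a value. *)

theory Defs
  imports Main
begin

section \<open>Subjective dissemination quorum systems\<close>

definition quorum_system :: "'n set \<Rightarrow> 'n set set \<Rightarrow> bool" where
  "quorum_system V \<Q> \<longleftrightarrow>
     \<Q> \<noteq> {} \<and> \<Q> \<subseteq> Pow V \<and>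
     (\<forall>U\<in>\<Q>. U \<noteq> {}) \<and>
     (\<forall>U\<^sub>1\<in>\<Q>. \<forall>U\<^sub>2\<in>\<Q>. U\<^sub>1 \<inter> U\<^sub>2 \<noteq> {}) \<and>
     (\<forall>U\<^sub>1\<in>\<Q>. \<forall>U\<^sub>2\<in>\<Q>. U\<^sub>1 \<union> U\<^sub>2 \<in> \<Q>)"

definition fail_prone_system :: "'n set \<Rightarrow> 'n set set \<Rightarrow> bool" where
  "fail_prone_system V \<B> \<longleftrightarrow>
     \<B> \<noteq> {} \<and> \<B> \<subseteq> Pow V \<and>
     (\<forall>B\<^sub>1\<in>\<B>. \<forall>B\<^sub>2\<in>\<B>. B\<^sub>1 \<subseteq> B\<^sub>2 \<longrightarrow> B\<^sub>1 = B\<^sub>2)"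

text \<open>The families \<open>\<Q>\<close> and \<open>\<B>\<close> are indexed by the correct servers: their values outside
  \<open>V_ok\<close> are irrelevant.\<close>

definition subjective_byzantine_quorum_system ::
  "'n set \<Rightarrow> 'n set \<Rightarrow> ('n \<Rightarrow> 'n set set) \<Rightarrow> ('n \<Rightarrow> 'n set set) \<Rightarrow> bool" where
  "subjective_byzantine_quorum_system V_ok V_bad \<Q> \<B> \<longleftrightarrow>
     (\<forall>v\<in>V_ok. quorum_system (V_ok \<union> V_bad) (\<Q> v) \<and> fail_prone_system (V_ok \<union> V_bad) (\<B> v))"

definition sd_safety :: "'n set \<Rightarrow> 'n set \<Rightarrow> ('n \<Rightarrow> 'n set set) \<Rightarrow> bool" where
  "sd_safety V_ok V_bad \<B> \<longleftrightarrow> (\<forall>v\<in>V_ok. \<exists>B\<in>\<B> v. V_bad \<subseteq> B)"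

definition sd_consistency ::
  "'n set \<Rightarrow> 'n set \<Rightarrow> ('n \<Rightarrow> 'n set set) \<Rightarrow> ('n \<Rightarrow> 'n set set) \<Rightarrow> bool" where
  "sd_consistency V_ok V_bad \<Q> \<B> \<longleftrightarrow>
     (\<forall>v\<in>V_ok. \<forall>U\<^sub>1\<in>\<Q> v. \<forall>U\<^sub>2\<in>(\<Union>v'\<in>V_ok. \<Q> v'). \<forall>B\<in>\<B> v.
        V_bad \<subseteq> B \<longrightarrow> \<not> U\<^sub>1 \<inter> U\<^sub>2 \<subseteq> B)"

definition sd_availability ::
  "'n set \<Rightarrow> ('n \<Rightarrow> 'n set set) \<Rightarrow> ('n \<Rightarrow> 'n set set) \<Rightarrow> bool" where
  "sd_availability V_ok \<Q> \<B> \<longleftrightarrow> (\<forall>v\<in>V_ok. \<forall>B\<in>\<B> v. \<exists>U\<in>\<Q> v. U \<inter> B = {})"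

definition subjective_dissemination_quorum_system ::
  "'n set \<Rightarrow> 'n set \<Rightarrow> ('n \<Rightarrow> 'n set set) \<Rightarrow> ('n \<Rightarrow> 'n set set) \<Rightarrow> bool" where
  "subjective_dissemination_quorum_system V_ok V_bad \<Q> \<B> \<longleftrightarrow>
     subjective_byzantine_quorum_system V_ok V_bad \<Q> \<B> \<and>
     sd_safety V_ok V_bad \<B> \<and> sd_consistency V_ok V_bad \<Q> \<B> \<and> sd_availability V_ok \<Q> \<B>"


section \<open>Nodes\<close>

record 'n network =
  clients :: "'n set"
  ok_clients :: "'n set"
  ok_servers :: "'n set"
  bad_servers :: "'n set"
  sender :: 'n

definition servers :: "'n network \<Rightarrow> 'n set" where
  "servers N = ok_servers N \<union> bad_servers N"

definition correct_nodes :: "'n network \<Rightarrow> 'n set" where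
  "correct_nodes N = ok_clients N \<union> ok_servers N"

definition system_model :: "'n network \<Rightarrow> bool" where
  "system_model N \<longleftrightarrow>
     clients N \<inter> servers N = {} \<and>
     ok_clients N \<subseteq> clients N \<and>
     ok_servers N \<inter> bad_servers N = {} \<and>
     finite (servers N) \<and> servers N \<noteq> {} \<and>
     sender N \<in> clients N"


section \<open>Reliable Byzantine broadcast\<close>

text \<open>A trace records which interface event, if any, occurs at each point in time. Only a correct
  sender produces \<open>Broadcast_event\<close>s, and only correct servers produce \<open>Deliver_event\<close>s.\<close>

datatype ('n, 'a) event = Broadcast_event 'a | Deliver_event 'n 'a

type_synonym ('n, 'a) trace = "nat \<Rightarrow> ('n, 'a) event option"

definition validity :: "'n network \<Rightarrow> ('n, 'a) trace \<Rightarrow> bool" where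
  "validity N \<tau> \<longleftrightarrow>
     (sender N \<in> ok_clients N \<longrightarrow>
       (\<forall>i a. \<tau> i = Some (Broadcast_event a) \<longrightarrow>
         (\<forall>v\<in>ok_servers N. \<exists>j. \<tau> j = Some (Deliver_event v a))))"

text \<open>At most one delivery per server: delivering the same value twice is excluded as well.\<close>

definition no_duplication :: "'n network \<Rightarrow> ('n, 'a) trace \<Rightarrow> bool" where
  "no_duplication N \<tau> \<longleftrightarrow>
     (\<forall>v\<in>ok_servers N. \<forall>i j a a'.
       \<tau> i = Some (Deliver_event v a) \<and> \<tau> j = Some (Deliver_event v a') \<longrightarrow> i = j)"

definition integrity :: "'n network \<Rightarrow> ('n, 'a) trace \<Rightarrow> bool" where
  "integrity N \<tau> \<longleftrightarrow>
     (\<forall>v\<in>ok_servers N. \<forall>i a.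
       \<tau> i = Some (Deliver_event v a) \<and> sender N \<in> ok_clients N \<longrightarrow>
         (\<exists>j<i. \<tau> j = Some (Broadcast_event a)))"

definition consistency :: "'n network \<Rightarrow> ('n, 'a) trace \<Rightarrow> bool" where
  "consistency N \<tau> \<longleftrightarrow>
     (\<forall>v\<in>ok_servers N. \<forall>v'\<in>ok_servers N. \<forall>i j a a'.
       \<tau> i = Some (Deliver_event v a) \<and> \<tau> j = Some (Deliver_event v' a') \<longrightarrow> a = a')"

definition totality :: "'n network \<Rightarrow> ('n, 'a) trace \<Rightarrow> bool" where
  "totality N \<tau> \<longleftrightarrow>
     (\<forall>v\<in>ok_servers N. \<forall>i a. \<tau> i = Some (Deliver_event v a) \<longrightarrow>
       (\<forall>v'\<in>ok_servers N. \<exists>j a'. \<tau> j = Some (Deliver_event v' a')))"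

definition reliable_byzantine_broadcast :: "'n network \<Rightarrow> ('n, 'a) trace \<Rightarrow> bool" where
  "reliable_byzantine_broadcast N \<tau> \<longleftrightarrow>
     validity N \<tau> \<and> no_duplication N \<tau> \<and> integrity N \<tau> \<and> consistency N \<tau> \<and> totality N \<tau>"


section \<open>Bracha broadcast\<close>

datatype 'a message = BCAST 'a | ECHO 'a | READY 'a

text \<open>\<open>(u, v, m) \<in> sent s\<close>: the correct node \<open>u\<close> has sent \<open>m\<close> to \<open>v\<close>. \<open>(u, m) \<in> rcvd s v\<close>: the
  correct node \<open>v\<close> has received \<open>m\<close> from \<open>u\<close>. The local state of faulty nodes is not tracked.\<close>

record ('n, 'a) state =
  sent :: "('n \<times> 'n \<times> 'a message) set"
  rcvd :: "'n \<Rightarrow> ('n \<times> 'a message) set"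
  echoed :: "'n \<Rightarrow> bool"
  ready :: "'n \<Rightarrow> bool"
  delivered :: "'n \<Rightarrow> bool"

definition initial_state :: "('n, 'a) state" where
  "initial_state =
     \<lparr>sent = {}, rcvd = (\<lambda>_. {}), echoed = (\<lambda>_. False), ready = (\<lambda>_. False),
      delivered = (\<lambda>_. False)\<rparr>"

definition send_to_servers ::
  "'n network \<Rightarrow> 'n \<Rightarrow> 'a message \<Rightarrow> ('n, 'a) state \<Rightarrow> ('n, 'a) state" where
  "send_to_servers N u m s = s\<lparr>sent := sent s \<union> {(u, v, m) | v. v \<in> servers N}\<rparr>"

datatype handler = Echo_Handler | Ready_Quorum_Handler | Ready_Blocking_Handler | Deliver_Handler

fun enabled ::
  "'n network \<Rightarrow> ('n \<Rightarrow> 'n set set) \<Rightarrow> ('n \<Rightarrow> 'n set set) \<Rightarrow>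
   handler \<Rightarrow> 'n \<Rightarrow> 'a \<Rightarrow> ('n, 'a) state \<Rightarrow> bool" where
  "enabled N \<Q> \<B> Echo_Handler v a s \<longleftrightarrow>
     (sender N, BCAST a) \<in> rcvd s v \<and> \<not> echoed s v"
| "enabled N \<Q> \<B> Ready_Quorum_Handler v a s \<longleftrightarrow>
     (\<exists>U\<in>\<Q> v. \<forall>u\<in>U. (u, ECHO a) \<in> rcvd s v) \<and> \<not> ready s v"
| "enabled N \<Q> \<B> Ready_Blocking_Handler v a s \<longleftrightarrow>
     (\<exists>B. B \<noteq> {} \<and> B \<subseteq> servers N \<and> (\<forall>B'\<in>\<B> v. \<not> B \<subseteq> B') \<and>
        (\<forall>u\<in>B. (u, READY a) \<in> rcvd s v)) \<and> \<not> ready s v"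
| "enabled N \<Q> \<B> Deliver_Handler v a s \<longleftrightarrow>
     (\<exists>U\<in>\<Q> v. \<forall>u\<in>U. (u, READY a) \<in> rcvd s v) \<and> \<not> delivered s v"

fun execute ::
  "'n network \<Rightarrow> handler \<Rightarrow> 'n \<Rightarrow> 'a \<Rightarrow> ('n, 'a) state \<Rightarrow> ('n, 'a) state" where
  "execute N Echo_Handler v a s =
     send_to_servers N v (ECHO a) (s\<lparr>echoed := (echoed s)(v := True)\<rparr>)"
| "execute N Ready_Quorum_Handler v a s =
     send_to_servers N v (READY a) (s\<lparr>ready := (ready s)(v := True)\<rparr>)"
| "execute N Ready_Blocking_Handler v a s =
     send_to_servers N v (READY a) (s\<lparr>ready := (ready s)(v := True)\<rparr>)"
| "execute N Deliver_Handler v a s =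
     s\<lparr>delivered := (delivered s)(v := True)\<rparr>"

text \<open>\<open>Receive u v m\<close>: the node \<open>v\<close> receives \<open>m\<close> from \<open>u\<close>. \<open>Idle\<close> stands for steps that no correct
  node takes part in; it also lets an execution in which nothing further happens be represented
  by an infinite sequence.\<close>

datatype ('n, 'a) action =
    Idle
  | Broadcast 'a
  | Receive 'n 'n "'a message"
  | Handle handler 'n 'a

text \<open>A correct node may receive any message from a faulty node at any time, which captures
  arbitrary Byzantine behaviour, but a message from a correct node only if it was sent.\<close>

inductive bracha_step ::
  "'n network \<Rightarrow> ('n \<Rightarrow> 'n set set) \<Rightarrow> ('n \<Rightarrow> 'n set set) \<Rightarrow>
   ('n, 'a) state \<Rightarrow> ('n, 'a) action \<Rightarrow> ('n, 'a) state \<Rightarrow> bool"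
  for N :: "'n network" and \<Q> \<B> :: "'n \<Rightarrow> 'n set set" where
  idle: "bracha_step N \<Q> \<B> s Idle s"
| broadcast:
    "sender N \<in> ok_clients N \<Longrightarrow>
     bracha_step N \<Q> \<B> s (Broadcast a) (send_to_servers N (sender N) (BCAST a) s)"
| receive:
    "v \<in> correct_nodes N \<Longrightarrow> u \<in> clients N \<union> servers N \<Longrightarrow>
     (u \<in> correct_nodes N \<Longrightarrow> (u, v, m) \<in> sent s) \<Longrightarrow>
     bracha_step N \<Q> \<B> s (Receive u v m)
       (s\<lparr>rcvd := (rcvd s)(v := insert (u, m) (rcvd s v))\<rparr>)"
| handle:
    "v \<in> ok_servers N \<Longrightarrow> enabled N \<Q> \<B> h v a s \<Longrightarrow>
     bracha_step N \<Q> \<B> s (Handle h v a) (execute N h v a s)"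

definition single_broadcast :: "(nat \<Rightarrow> ('n, 'a) action) \<Rightarrow> bool" where
  "single_broadcast \<alpha> \<longleftrightarrow> (\<forall>i j a a'. \<alpha> i = Broadcast a \<and> \<alpha> j = Broadcast a' \<longrightarrow> a = a')"

definition reliable_channels ::
  "'n network \<Rightarrow> (nat \<Rightarrow> ('n, 'a) state) \<Rightarrow> bool" where
  "reliable_channels N \<sigma> \<longleftrightarrow>
     (\<forall>u\<in>correct_nodes N. \<forall>v\<in>correct_nodes N. \<forall>m i.
       (u, v, m) \<in> sent (\<sigma> i) \<longrightarrow> (\<exists>j\<ge>i. (u, m) \<in> rcvd (\<sigma> j) v))"

definition fair_handlers ::
  "'n network \<Rightarrow> ('n \<Rightarrow> 'n set set) \<Rightarrow> ('n \<Rightarrow> 'n set set) \<Rightarrow>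
   (nat \<Rightarrow> ('n, 'a) state) \<Rightarrow> (nat \<Rightarrow> ('n, 'a) action) \<Rightarrow> bool" where
  "fair_handlers N \<Q> \<B> \<sigma> \<alpha> \<longleftrightarrow>
     (\<forall>v\<in>ok_servers N. \<forall>h a i.
       (\<forall>j\<ge>i. enabled N \<Q> \<B> h v a (\<sigma> j)) \<longrightarrow> (\<exists>j\<ge>i. \<alpha> j = Handle h v a))"

definition complete_bracha_execution ::
  "'n network \<Rightarrow> ('n \<Rightarrow> 'n set set) \<Rightarrow> ('n \<Rightarrow> 'n set set) \<Rightarrow>
   (nat \<Rightarrow> ('n, 'a) state) \<Rightarrow> (nat \<Rightarrow> ('n, 'a) action) \<Rightarrow> bool" where
  "complete_bracha_execution N \<Q> \<B> \<sigma> \<alpha> \<longleftrightarrow>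
     \<sigma> 0 = initial_state \<and>
     (\<forall>i. bracha_step N \<Q> \<B> (\<sigma> i) (\<alpha> i) (\<sigma> (Suc i))) \<and>
     single_broadcast \<alpha> \<and> reliable_channels N \<sigma> \<and> fair_handlers N \<Q> \<B> \<sigma> \<alpha>"

fun observe :: "('n, 'a) action \<Rightarrow> ('n, 'a) event option" where
  "observe (Broadcast a) = Some (Broadcast_event a)"
| "observe (Handle Deliver_Handler v a) = Some (Deliver_event v a)"
| "observe _ = None"

definition bracha_traces ::
  "'n network \<Rightarrow> ('n \<Rightarrow> 'n set set) \<Rightarrow> ('n \<Rightarrow> 'n set set) \<Rightarrow> ('n, 'a) trace set" where
  "bracha_traces N \<Q> \<B> = {observe \<circ> \<alpha> | \<sigma> \<alpha>. complete_bracha_execution N \<Q> \<B> \<sigma> \<alpha>}"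

end

(* Safety: all READYs sent by correct servers trace back to a quorum of ECHOs (a READY amplified
   from a blocking set relies on an earlier READY of a correct server), and two quorums, even of
   different servers, share a correct server, which echoes only once. So correct servers send READY
   for, and hence deliver, a single value.
   Liveness: every correct server has a quorum of correct servers. Moreover, the correct part of any
   quorum U of any correct server is blocking for every correct server v: if it were contained in
   some fail-prone set B of v, a quorum of v avoiding B would meet U only in faulty servers. Hence
   one delivery makes every correct server ready, and then every correct server delivers. *)
theory Submission
  imports Defs
begin

text \<open>Each of finitely many monotone conditions holds from some time on; the maximum of these
  times serves for all. It provides one moment at which the messages of a whole set of correct
  servers have arrived.\<close>

lemma eventually_all_finite:
  fixes P :: "'b \<Rightarrow> nat \<Rightarrow> bool"
  assumes "finite A" and "\<And>x. x \<in> A \<Longrightarrow> \<exists>i. P x i"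
    and mono: "\<And>x i j. P x i \<Longrightarrow> i \<le> j \<Longrightarrow> P x j"
  shows "\<exists>i. \<forall>x\<in>A. P x i"
  using assms(1,2)
proof (induction A rule: finite_induct)
  case (insert x A)
  then obtain i k where "\<forall>y\<in>A. P y i" "P x k" by blast
  then have "\<forall>y\<in>insert x A. P y (max i k)" using mono by (metis insert_iff max.cobounded1 max.cobounded2)
  then show ?case by blast
qed simp

section \<open>A fixed complete execution and its events\<close>

locale bracha_execution =
  fixes N :: "'n network" and \<Q> \<B> :: "'n \<Rightarrow> 'n set set"
    and \<sigma> :: "nat \<Rightarrow> ('n, 'a) state" and \<alpha> :: "nat \<Rightarrow> ('n, 'a) action"
  assumes model: "system_model N"
    and quorums: "subjective_dissemination_quorum_system (ok_servers N) (bad_servers N) \<Q> \<B>"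
    and execution: "complete_bracha_execution N \<Q> \<B> \<sigma> \<alpha>"
begin

abbreviation "V_ok \<equiv> ok_servers N"
abbreviation "V_bad \<equiv> bad_servers N"

definition echoes :: "nat \<Rightarrow> 'n \<Rightarrow> 'a \<Rightarrow> bool" where
  "echoes i v a \<longleftrightarrow> \<alpha> i = Handle Echo_Handler v a"

text \<open>Both ready handlers count as one event: they set the same flag and send the same
  message.\<close>

definition readies :: "nat \<Rightarrow> 'n \<Rightarrow> 'a \<Rightarrow> bool" where
  "readies i v a \<longleftrightarrow>
     \<alpha> i = Handle Ready_Quorum_Handler v a \<or> \<alpha> i = Handle Ready_Blocking_Handler v a"

definition delivers :: "nat \<Rightarrow> 'n \<Rightarrow> 'a \<Rightarrow> bool" where
  "delivers i v a \<longleftrightarrow> \<alpha> i = Handle Deliver_Handler v a"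

lemmas event_defs = echoes_def readies_def delivers_def


subsection \<open>Quorums and correct servers\<close>

lemma servers_correct [simp]: "v \<in> V_ok \<Longrightarrow> v \<in> servers N" "v \<in> V_ok \<Longrightarrow> v \<in> correct_nodes N"
  by (auto simp: servers_def correct_nodes_def)

lemma finite_V_ok: "finite V_ok"
  using model by (simp add: system_model_def servers_def)

lemma quorum_subset: "v \<in> V_ok \<Longrightarrow> U \<in> \<Q> v \<Longrightarrow> U \<subseteq> V_ok \<union> V_bad"
  using quorums unfolding subjective_dissemination_quorum_system_def
    subjective_byzantine_quorum_system_def quorum_system_def by blast

lemma fail_prone_nonempty: "v \<in> V_ok \<Longrightarrow> \<B> v \<noteq> {}"
  using quorums unfolding subjective_dissemination_quorum_system_def
    subjective_byzantine_quorum_system_def fail_prone_system_def by blast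

lemma fail_prone_covers_bad: "v \<in> V_ok \<Longrightarrow> \<exists>B\<in>\<B> v. V_bad \<subseteq> B"
  using quorums unfolding subjective_dissemination_quorum_system_def sd_safety_def by blast

lemma quorum_avoiding: "v \<in> V_ok \<Longrightarrow> B \<in> \<B> v \<Longrightarrow> \<exists>U\<in>\<Q> v. U \<inter> B = {}"
  using quorums unfolding subjective_dissemination_quorum_system_def sd_availability_def by blast

text \<open>By SD-safety some fail-prone set \<open>B\<close> of \<open>v\<close> covers all faulty
  servers, and by SD-consistency the intersection leaves \<open>B\<close>. Taking
  \<open>U' = U\<close> yields a correct member of a single quorum.\<close>

lemma quorums_share_correct:
  assumes v: "v \<in> V_ok" "U \<in> \<Q> v" "v' \<in> V_ok" "U' \<in> \<Q> v'"
  obtains u where "u \<in> U" "u \<in> U'" "u \<in> V_ok"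
proof -
  obtain B where "B \<in> \<B> v" "V_bad \<subseteq> B" using fail_prone_covers_bad v by blast
  then have "\<not> U \<inter> U' \<subseteq> B"
    using quorums v unfolding subjective_dissemination_quorum_system_def sd_consistency_def by blast
  then show thesis using that quorum_subset[OF v(1,2)] \<open>V_bad \<subseteq> B\<close> by blast
qed

lemma quorum_of_correct:
  assumes "v \<in> V_ok" obtains U where "U \<in> \<Q> v" "U \<subseteq> V_ok"
proof -
  obtain B U where "V_bad \<subseteq> B" "U \<in> \<Q> v" "U \<inter> B = {}"
    using fail_prone_covers_bad quorum_avoiding assms by metis
  then show thesis using that quorum_subset[OF assms] by blast
qed

text \<open>Otherwise \<open>W\<close> would consist of faulty servers only and lie inside the
  fail-prone set that SD-safety provides.\<close>

lemma blocking_contains_correct: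
  assumes "v \<in> V_ok" "W \<subseteq> servers N" "\<forall>B\<in>\<B> v. \<not> W \<subseteq> B"
  obtains u where "u \<in> W" "u \<in> V_ok"
  using assms fail_prone_covers_bad[of v] unfolding servers_def by blast

text \<open>\<open>B\<close> is any fail-prone set of \<open>v'\<close>, not just one covering
  \<open>V_bad\<close>: the blocking condition of the third handler quantifies over all of
  them.\<close>

lemma correct_part_of_quorum_blocking:
  assumes "v \<in> V_ok" "U \<in> \<Q> v" "v' \<in> V_ok" "B \<in> \<B> v'"
  shows "\<not> U \<inter> V_ok \<subseteq> B"
proof -
  obtain U' where U': "U' \<in> \<Q> v'" "U' \<inter> B = {}" using quorum_avoiding assms by blast
  obtain u where "u \<in> U" "u \<in> U'" "u \<in> V_ok" by (rule quorums_share_correct[OF assms(1-3) U'(1)])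
  then show ?thesis using U' by blast
qed


subsection \<open>States in terms of past actions\<close>

lemma initial: "\<sigma> 0 = initial_state"
  using execution by (simp add: complete_bracha_execution_def)

lemma step: "bracha_step N \<Q> \<B> (\<sigma> i) (\<alpha> i) (\<sigma> (Suc i))"
  using execution by (simp add: complete_bracha_execution_def)

lemma handleD:
  assumes "\<alpha> i = Handle h v a"
  shows "v \<in> V_ok" "enabled N \<Q> \<B> h v a (\<sigma> i)"
  using step[of i] assms by (auto elim: bracha_step.cases)

lemma broadcastD: "\<alpha> i = Broadcast a \<Longrightarrow> sender N \<in> ok_clients N"
  using step[of i] by (auto elim: bracha_step.cases)

lemma receiveD: "\<alpha> i = Receive u v m \<Longrightarrow> u \<in> correct_nodes N \<Longrightarrow> (u, v, m) \<in> sent (\<sigma> i)"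
  using step[of i] by (auto elim: bracha_step.cases)

lemma broadcast_unique: "\<alpha> i = Broadcast a \<Longrightarrow> \<alpha> j = Broadcast a' \<Longrightarrow> a = a'"
  using execution by (auto simp: complete_bracha_execution_def single_broadcast_def)

text \<open>This and the following equivalences replace state components by the history of actions.
  The bound is strict because \<open>\<sigma> i\<close> is the state before action
  \<open>\<alpha> i\<close>.\<close>

lemma rcvd_iff: "(u, m) \<in> rcvd (\<sigma> i) v \<longleftrightarrow> (\<exists>j<i. \<alpha> j = Receive u v m)"
proof (induction i)
  case (Suc i)
  have "(u, m) \<in> rcvd (\<sigma> (Suc i)) v \<longleftrightarrow> (u, m) \<in> rcvd (\<sigma> i) v \<or> \<alpha> i = Receive u v m"
    using step[of i]
  proof cases
    case (handle v h a)
    then show ?thesis by (cases h) (auto simp: send_to_servers_def)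
  qed (auto simp: send_to_servers_def)
  then show ?case using Suc by (auto simp: less_Suc_eq)
qed (simp add: initial initial_state_def)

lemma echoed_iff: "echoed (\<sigma> i) v \<longleftrightarrow> (\<exists>j<i. \<exists>a. echoes j v a)"
proof (induction i)
  case (Suc i)
  have "echoed (\<sigma> (Suc i)) v \<longleftrightarrow> echoed (\<sigma> i) v \<or> (\<exists>a. echoes i v a)"
    using step[of i]
  proof cases
    case (handle v h a)
    then show ?thesis by (cases h) (auto simp: send_to_servers_def event_defs)
  qed (auto simp: send_to_servers_def event_defs)
  then show ?case using Suc by (auto simp: less_Suc_eq)
qed (simp add: initial initial_state_def)

lemma ready_iff: "ready (\<sigma> i) v \<longleftrightarrow> (\<exists>j<i. \<exists>a. readies j v a)"
proof (induction i)
  case (Suc i)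
  have "ready (\<sigma> (Suc i)) v \<longleftrightarrow> ready (\<sigma> i) v \<or> (\<exists>a. readies i v a)"
    using step[of i]
  proof cases
    case (handle v h a)
    then show ?thesis by (cases h) (auto simp: send_to_servers_def event_defs)
  qed (auto simp: send_to_servers_def event_defs)
  then show ?case using Suc by (auto simp: less_Suc_eq)
qed (simp add: initial initial_state_def)

lemma delivered_iff: "delivered (\<sigma> i) v \<longleftrightarrow> (\<exists>j<i. \<exists>a. delivers j v a)"
proof (induction i)
  case (Suc i)
  have "delivered (\<sigma> (Suc i)) v \<longleftrightarrow> delivered (\<sigma> i) v \<or> (\<exists>a. delivers i v a)"
    using step[of i]
  proof cases
    case (handle v h a)
    then show ?thesis by (cases h) (auto simp: send_to_servers_def event_defs)
  qed (auto simp: send_to_servers_def event_defs)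
  then show ?case using Suc by (auto simp: less_Suc_eq)
qed (simp add: initial initial_state_def)

fun sends :: "nat \<Rightarrow> 'n \<Rightarrow> 'a message \<Rightarrow> bool" where
  "sends i u (BCAST a) \<longleftrightarrow> u = sender N \<and> \<alpha> i = Broadcast a"
| "sends i u (ECHO a) \<longleftrightarrow> echoes i u a"
| "sends i u (READY a) \<longleftrightarrow> readies i u a"

lemma sent_iff: "(u, v, m) \<in> sent (\<sigma> i) \<longleftrightarrow> v \<in> servers N \<and> (\<exists>j<i. sends j u m)"
proof (induction i)
  case (Suc i)
  have "(u, v, m) \<in> sent (\<sigma> (Suc i)) \<longleftrightarrow> (u, v, m) \<in> sent (\<sigma> i) \<or> v \<in> servers N \<and> sends i u m"
    using step[of i]
  proof cases
    case (handle v h a)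
    then show ?thesis by (cases h; cases m) (auto simp: send_to_servers_def event_defs)
  qed (cases m; auto simp: send_to_servers_def event_defs)+
  then show ?case using Suc by (auto simp: less_Suc_eq)
qed (simp add: initial initial_state_def)

lemma rcvd_mono: "(u, m) \<in> rcvd (\<sigma> i) v \<Longrightarrow> i \<le> j \<Longrightarrow> (u, m) \<in> rcvd (\<sigma> j) v"
  unfolding rcvd_iff by (meson order_less_le_trans)

lemma rcvd_from_correct:
  assumes "(u, m) \<in> rcvd (\<sigma> i) v" "u \<in> correct_nodes N"
  shows "\<exists>j<i. sends j u m"
  using assms receiveD unfolding rcvd_iff sent_iff by (meson order_less_trans)

lemma eventually_rcvd:
  assumes "sends i u m" "u \<in> correct_nodes N" "v \<in> V_ok"
  shows "\<exists>j. (u, m) \<in> rcvd (\<sigma> j) v"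
proof -
  \<comment> \<open>A message sent by action \<open>i\<close> shows up in the state after that
    action.\<close>
  have "(u, v, m) \<in> sent (\<sigma> (Suc i))" using assms by (auto simp: sent_iff)
  then show ?thesis
    using execution assms servers_correct(2)[OF assms(3)]
    unfolding complete_bracha_execution_def reliable_channels_def by blast
qed

lemma eventually_rcvd_all:
  assumes "U \<subseteq> V_ok" "\<And>u. u \<in> U \<Longrightarrow> \<exists>i. sends i u m" "v \<in> V_ok"
  obtains j where "\<forall>u\<in>U. \<forall>k\<ge>j. (u, m) \<in> rcvd (\<sigma> k) v"
proof -
  have "\<exists>j. \<forall>u\<in>U. (u, m) \<in> rcvd (\<sigma> j) v"
  proof (rule eventually_all_finite)
    show "finite U" using assms(1) finite_V_ok finite_subset by blast
    show "\<exists>j. (u, m) \<in> rcvd (\<sigma> j) v" if "u \<in> U" for u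
      using assms that eventually_rcvd servers_correct by blast
  qed (rule rcvd_mono)
  then show thesis using that rcvd_mono by blast
qed

text \<open>The contrapositive form of handler fairness. In the liveness proofs the triggering
  messages stay received, so a disabled handler means that its flag is set, hence that the
  corresponding event has already happened, possibly for another value.\<close>

lemma fairness:
  assumes "v \<in> V_ok" shows "\<exists>j\<ge>i. \<not> enabled N \<Q> \<B> h v a (\<sigma> j) \<or> \<alpha> j = Handle h v a"
  using execution assms unfolding complete_bracha_execution_def fair_handlers_def by blast


subsection \<open>Safety\<close>

text \<open>The later of two echo events would have run with \<open>echoed\<close> already
  true.\<close>

lemma echo_unique:
  assumes "echoes i u a" "echoes j u a'" shows "a = a'"
proof -
  have "\<not> k < l" if "echoes k u b" "echoes l u b'" for k l b b'
    using handleD(2)[of l Echo_Handler u b'] that echoed_iff unfolding echoes_def by auto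
  then show ?thesis using assms by (cases i j rule: linorder_cases) (auto simp: echoes_def)
qed

lemma deliver_unique:
  assumes "delivers i u a" "delivers j u a'" shows "i = j"
proof -
  have "\<not> k < l" if "delivers k u b" "delivers l u b'" for k l b b'
    using handleD(2)[of l Deliver_Handler u b'] that delivered_iff unfolding delivers_def by auto
  then show ?thesis using assms by (meson linorder_neqE_nat)
qed

text \<open>Strong induction on time. The owner \<open>v'\<close> of the quorum need not be
  \<open>v\<close>: it is the server at the start of the chain of amplifications, which became ready
  through the quorum handler.\<close>

lemma ready_needs_echo_quorum:
  assumes "readies i v a"
  shows "\<exists>v'\<in>V_ok. \<exists>U\<in>\<Q> v'. \<forall>u\<in>U \<inter> V_ok. \<exists>j<i. echoes j u a"
  using assms
proof (induction i arbitrary: v rule: less_induct)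
  case (less i)
  from less.prems consider (quorum) "\<alpha> i = Handle Ready_Quorum_Handler v a"
    | (blocking) "\<alpha> i = Handle Ready_Blocking_Handler v a" unfolding readies_def by blast
  then show ?case
  proof cases
    case quorum
    then obtain U where U: "U \<in> \<Q> v" "\<forall>u\<in>U. (u, ECHO a) \<in> rcvd (\<sigma> i) v"
      using handleD(2)[OF quorum] unfolding enabled.simps by blast
    have "\<exists>j<i. echoes j u a" if "u \<in> U \<inter> V_ok" for u
      using that U(2) rcvd_from_correct[of u "ECHO a" i v] by auto
    then show ?thesis using U(1) handleD(1)[OF quorum] by blast
  next
    case blocking
    then obtain W where W: "W \<subseteq> servers N" "\<forall>B\<in>\<B> v. \<not> W \<subseteq> B"
      "\<forall>u\<in>W. (u, READY a) \<in> rcvd (\<sigma> i) v"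
      using handleD(2)[OF blocking] unfolding enabled.simps by blast
    \<comment> \<open>A correct member of the blocking set sent its READY strictly earlier, so the
      induction hypothesis applies to it.\<close>
    obtain u where u: "u \<in> W" "u \<in> V_ok"
      by (rule blocking_contains_correct[OF handleD(1)[OF blocking] W(1,2)])
    then obtain j where "j < i" "readies j u a"
      using W(3) rcvd_from_correct[of u "READY a" i v] by auto
    with less.IH show ?thesis by (meson order_less_trans)
  qed
qed

lemma ready_agreement:
  assumes "readies i v a" "readies j v' a'" shows "a = a'"
proof -
  obtain w U where U: "w \<in> V_ok" "U \<in> \<Q> w" "\<forall>u\<in>U \<inter> V_ok. \<exists>j<i. echoes j u a"
    using ready_needs_echo_quorum[OF assms(1)] by blast
  obtain w' U' where U': "w' \<in> V_ok" "U' \<in> \<Q> w'" "\<forall>u\<in>U' \<inter> V_ok. \<exists>i<j. echoes i u a'"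
    using ready_needs_echo_quorum[OF assms(2)] by blast
  obtain u where "u \<in> U" "u \<in> U'" "u \<in> V_ok" by (rule quorums_share_correct[OF U(1,2) U'(1,2)])
  then show ?thesis using U(3) U'(3) echo_unique by (meson IntI)
qed

lemma deliver_needs_ready_quorum:
  assumes "delivers i v a"
  obtains U where "v \<in> V_ok" "U \<in> \<Q> v" "\<forall>u\<in>U \<inter> V_ok. \<exists>j<i. readies j u a"
proof -
  obtain U where U: "U \<in> \<Q> v" "\<forall>u\<in>U. (u, READY a) \<in> rcvd (\<sigma> i) v"
    using handleD(2)[OF assms[unfolded delivers_def]] unfolding enabled.simps by blast
  have "\<exists>j<i. readies j u a" if "u \<in> U \<inter> V_ok" for u
    using that U(2) rcvd_from_correct[of u "READY a" i v] by auto
  then show thesis using that U(1) handleD(1)[OF assms[unfolded delivers_def]] by blast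
qed

lemma deliver_needs_ready:
  assumes "delivers i v a" obtains j u where "j < i" "readies j u a"
proof -
  obtain U where U: "v \<in> V_ok" "U \<in> \<Q> v" "\<forall>u\<in>U \<inter> V_ok. \<exists>j<i. readies j u a"
    by (rule deliver_needs_ready_quorum[OF assms])
  \<comment> \<open>Intersecting \<open>U\<close> with itself produces a correct member.\<close>
  obtain u where "u \<in> U" "u \<in> V_ok" by (rule quorums_share_correct[OF U(1,2) U(1,2)])
  then show thesis using that U(3) by blast
qed

lemma deliver_agreement: "delivers i v a \<Longrightarrow> delivers j v' a' \<Longrightarrow> a = a'"
  by (metis deliver_needs_ready ready_agreement)

section \<open>Integrity: tracing values back to a correct sender\<close>

lemma echo_needs_broadcast:
  assumes "echoes i v a" "sender N \<in> ok_clients N"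
  shows "\<exists>j<i. \<alpha> j = Broadcast a"
proof -
  have "(sender N, BCAST a) \<in> rcvd (\<sigma> i) v"
    using handleD(2)[OF assms(1)[unfolded echoes_def]] by simp
  moreover have "sender N \<in> correct_nodes N" using assms(2) by (simp add: correct_nodes_def)
  ultimately show ?thesis using rcvd_from_correct by fastforce
qed

lemma ready_needs_broadcast:
  assumes "readies i v a" "sender N \<in> ok_clients N"
  shows "\<exists>j<i. \<alpha> j = Broadcast a"
proof -
  obtain w U where U: "w \<in> V_ok" "U \<in> \<Q> w" "\<forall>u\<in>U \<inter> V_ok. \<exists>j<i. echoes j u a"
    using ready_needs_echo_quorum[OF assms(1)] by blast
  obtain u where "u \<in> U" "u \<in> V_ok" by (rule quorums_share_correct[OF U(1,2) U(1,2)])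
  then obtain j where "j < i" "echoes j u a" using U(3) by blast
  then show ?thesis using echo_needs_broadcast assms(2) by (meson order_less_trans)
qed

lemma deliver_needs_broadcast:
  assumes "delivers i v a" "sender N \<in> ok_clients N"
  shows "\<exists>j<i. \<alpha> j = Broadcast a"
proof -
  obtain k u where "k < i" "readies k u a" by (rule deliver_needs_ready[OF assms(1)])
  then show ?thesis using ready_needs_broadcast assms(2) by (meson order_less_trans)
qed


subsection \<open>Liveness\<close>

text \<open>The echoed value may differ from \<open>a\<close>: a faulty sender can have triggered an
  earlier echo of something else.\<close>

lemma eventually_echoes:
  assumes "(sender N, BCAST a) \<in> rcvd (\<sigma> i) v" "v \<in> V_ok"
  shows "\<exists>j a'. echoes j v a'"
proof -
  obtain j where "j \<ge> i" "\<not> enabled N \<Q> \<B> Echo_Handler v a (\<sigma> j) \<or> echoes j v a"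
    using fairness[OF assms(2)] unfolding echoes_def by blast
  then show ?thesis using rcvd_mono[OF assms(1)] by (auto simp: echoed_iff)
qed

lemma eventually_readies_if_quorum_echoes:
  assumes "v \<in> V_ok" "U \<in> \<Q> v" "U \<subseteq> V_ok" "\<And>u. u \<in> U \<Longrightarrow> \<exists>i. echoes i u a"
  shows "\<exists>j a'. readies j v a'"
proof -
  obtain i where i: "\<forall>u\<in>U. \<forall>k\<ge>i. (u, ECHO a) \<in> rcvd (\<sigma> k) v"
    by (rule eventually_rcvd_all[OF assms(3) _ assms(1), where m = "ECHO a"]) (use assms in auto)
  obtain j where "j \<ge> i" "\<not> enabled N \<Q> \<B> Ready_Quorum_Handler v a (\<sigma> j) \<or> readies j v a"
    using fairness[OF assms(1)] unfolding readies_def by blast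
  moreover have "\<exists>U\<in>\<Q> v. \<forall>u\<in>U. (u, ECHO a) \<in> rcvd (\<sigma> j) v" using i \<open>j \<ge> i\<close> assms(2) by blast
  ultimately show ?thesis by (auto simp: ready_iff)
qed

lemma eventually_readies_if_blocking_readies:
  assumes "v \<in> V_ok" "W \<subseteq> V_ok" "\<forall>B\<in>\<B> v. \<not> W \<subseteq> B" "\<And>u. u \<in> W \<Longrightarrow> \<exists>i. readies i u a"
  shows "\<exists>j a'. readies j v a'"
proof -
  obtain i where i: "\<forall>u\<in>W. \<forall>k\<ge>i. (u, READY a) \<in> rcvd (\<sigma> k) v"
    by (rule eventually_rcvd_all[OF assms(2) _ assms(1), where m = "READY a"]) (use assms in auto)
  obtain j where "j \<ge> i" "\<not> enabled N \<Q> \<B> Ready_Blocking_Handler v a (\<sigma> j) \<or> readies j v a"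
    using fairness[OF assms(1)] unfolding readies_def by blast
  \<comment> \<open>The empty set would be contained in any fail-prone set of \<open>v\<close>, and
    there is at least one.\<close>
  have "W \<noteq> {}" using assms(3) fail_prone_nonempty[OF assms(1)] by blast
  moreover have "W \<subseteq> servers N" using assms(2) by (auto simp: servers_def)
  moreover have "\<forall>u\<in>W. (u, READY a) \<in> rcvd (\<sigma> j) v" using i \<open>j \<ge> i\<close> by simp
  ultimately have "\<exists>B. B \<noteq> {} \<and> B \<subseteq> servers N \<and> (\<forall>B'\<in>\<B> v. \<not> B \<subseteq> B') \<and>
      (\<forall>u\<in>B. (u, READY a) \<in> rcvd (\<sigma> j) v)"
    using assms(3) by (intro exI[of _ W]) simp
  with \<open>\<not> enabled N \<Q> \<B> Ready_Blocking_Handler v a (\<sigma> j) \<or> readies j v a\<close>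
  have "ready (\<sigma> j) v \<or> readies j v a" by simp
  then show ?thesis unfolding ready_iff by blast
qed

lemma eventually_delivers:
  assumes readies: "\<And>u. u \<in> V_ok \<Longrightarrow> \<exists>i a. readies i u a" and v: "v \<in> V_ok"
  shows "\<exists>j a'. delivers j v a'"
proof -
  \<comment> \<open>The READY of \<open>v\<close> itself fixes the value \<open>a\<close>; by
    agreement all other correct servers are ready for the same value.\<close>
  obtain k a where "readies k v a" using readies v by blast
  then have all: "\<exists>i. readies i u a" if "u \<in> V_ok" for u
    using readies[OF that] ready_agreement by blast
  obtain U where U: "U \<in> \<Q> v" "U \<subseteq> V_ok" by (rule quorum_of_correct[OF v])
  obtain i where i: "\<forall>u\<in>U. \<forall>k\<ge>i. (u, READY a) \<in> rcvd (\<sigma> k) v"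
    by (rule eventually_rcvd_all[OF U(2) _ v, where m = "READY a"]) (use all U in auto)
  obtain j where "j \<ge> i" "\<not> enabled N \<Q> \<B> Deliver_Handler v a (\<sigma> j) \<or> delivers j v a"
    using fairness[OF v] unfolding delivers_def by blast
  moreover have "\<exists>U\<in>\<Q> v. \<forall>u\<in>U. (u, READY a) \<in> rcvd (\<sigma> j) v" using i \<open>j \<ge> i\<close> U(1) by blast
  ultimately show ?thesis by (auto simp: delivered_iff)
qed

section \<open>Validity and totality\<close>

lemma broadcast_eventually_delivers:
  assumes bc: "\<alpha> i = Broadcast a" and v: "v \<in> V_ok"
  shows "\<exists>j. delivers j v a"
proof -
  have sender: "sender N \<in> ok_clients N" "sender N \<in> correct_nodes N"
    using broadcastD[OF bc] by (auto simp: correct_nodes_def)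
  have echo: "\<exists>j. echoes j u a" if u: "u \<in> V_ok" for u
  proof -
    obtain k where "(sender N, BCAST a) \<in> rcvd (\<sigma> k) u"
      using eventually_rcvd[of i "sender N" "BCAST a" u] bc sender(2) u by auto
    then obtain j a' where "echoes j u a'" using eventually_echoes u by blast
    \<comment> \<open>Whatever was echoed was broadcast by the correct sender, who broadcasts only
      one value; hence \<open>a' = a\<close>.\<close>
    then show ?thesis using echo_needs_broadcast[OF _ sender(1)] broadcast_unique[OF bc] by blast
  qed
  have "\<exists>j a'. readies j u a'" if u: "u \<in> V_ok" for u
  proof -
    obtain U where "U \<in> \<Q> u" "U \<subseteq> V_ok" by (rule quorum_of_correct[OF u])
    then show ?thesis using eventually_readies_if_quorum_echoes[OF u] echo by blast
  qed
  then obtain j a' where "delivers j v a'" using eventually_delivers v by blast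
  then show ?thesis
    using deliver_needs_broadcast[OF _ sender(1)] broadcast_unique[OF bc] by blast
qed

lemma deliver_eventually_delivers:
  assumes "delivers i v a" "v' \<in> V_ok"
  shows "\<exists>j a'. delivers j v' a'"
proof (rule eventually_delivers)
  obtain U where U: "v \<in> V_ok" "U \<in> \<Q> v" "\<forall>u\<in>U \<inter> V_ok. \<exists>j<i. readies j u a"
    by (rule deliver_needs_ready_quorum[OF assms(1)])
  show "\<exists>j a'. readies j u a'" if "u \<in> V_ok" for u
  proof (rule eventually_readies_if_blocking_readies[OF that])
    \<comment> \<open>The blocking set is the correct part of the quorum behind the given delivery;
      all its members sent READY for \<open>a\<close>.\<close>
    show "\<forall>B\<in>\<B> u. \<not> U \<inter> V_ok \<subseteq> B"
      using correct_part_of_quorum_blocking[OF U(1,2) that] by blast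
  qed (use U(3) in blast)+
qed (rule assms(2))

section \<open>From actions to interface traces\<close>

lemma observe_iff:
  "(observe \<circ> \<alpha>) i = Some (Broadcast_event a) \<longleftrightarrow> \<alpha> i = Broadcast a"
  "(observe \<circ> \<alpha>) i = Some (Deliver_event v a) \<longleftrightarrow> delivers i v a"
  by (cases "\<alpha> i" rule: observe.cases; simp add: delivers_def)+

lemma implements_reliable_byzantine_broadcast: "reliable_byzantine_broadcast N (observe \<circ> \<alpha>)"
  unfolding reliable_byzantine_broadcast_def validity_def no_duplication_def integrity_def
    consistency_def totality_def observe_iff
  by (intro conjI)
    (meson broadcast_eventually_delivers deliver_unique deliver_needs_broadcast deliver_agreement
      deliver_eventually_delivers)+

end

theorem theorem26:
  fixes N :: "'n network" and \<Q> \<B> :: "'n \<Rightarrow> 'n set set"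
  assumes "system_model N"
    and "subjective_dissemination_quorum_system (ok_servers N) (bad_servers N) \<Q> \<B>"
  shows "\<forall>\<tau> \<in> (bracha_traces N \<Q> \<B> :: ('n, 'a) trace set). reliable_byzantine_broadcast N \<tau>"
proof
  fix \<tau> :: "('n, 'a) trace"
  assume "\<tau> \<in> bracha_traces N \<Q> \<B>"
  then obtain \<sigma> \<alpha> where "\<tau> = observe \<circ> \<alpha>" "complete_bracha_execution N \<Q> \<B> \<sigma> \<alpha>"
    unfolding bracha_traces_def by blast
  with assms show "reliable_byzantine_broadcast N \<tau>"
    using bracha_execution.implements_reliable_byzantine_broadcast bracha_execution.intro by blast
qed

end
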